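(* Let $G=SL_2(\mathbf{R})$ or $G=SL_3(\mathbf{R})$ with the standard pinning. Then the map $$\Theta:\{(u,u',t)\in U^-_{>0}\times U^-_{>0}\times T_{>0}:\ t\in\mathcal{T}_{u,u'}\}\to U^-_{>0}\times U^-_{>0}\times\mathbf{R}_{>0}^I,\qquad (u,u',t)\mapsto\bigl(u,u',(Z_j(tut^{-1}u'^{-1}))_{j\in I}\bigr)$$ is a homeomorphism.
   Context: All sets of real matrices carry the usual topology. For $G=SL_n(\mathbf{R})$ with $n\in\{2,3\}$ and its standard pinning: $I=\{1,\dots,n-1\}$; $U^-$ is the group of lower triangular unipotent matrices; $y_i(a)=1+aE_{i+1,i}$; $T_{>0}$ is the group of diagonal matrices of determinant $1$ with positive diagonal entries. For $u,u'\in U^-_{>0}$, $\mathcal{T}_{u,u'}=\{t\in T_{>0}: tut^{-1}u'^{-1}\in U^-_{>0}\}$. In general, $U^-_{>0}$ is the set of products $y_{i_1}(a_1)\cdots y_{i_N}(a_N)$, $a_k\in\mathbf{R}_{>0}$, where $s_{i_1}\cdots s_{i_N}$ is a reduced expression of the longest element of the Weyl group, and $Z_j(u)$ is the coefficient of the lowest weight canonical basis vector in $u e_{\omega(j)}$, where $e_{\omega(j)}$ is the highest weight vector in the canonical basis of the $j$-th fundamental representation. Explicitly: For $n=2$: $U^-_{>0}=\left\{\begin{pmatrix}1 & 0 \\ a & 1\end{pmatrix}: a>0\right\}$, and $Z_1\begin{pmatrix}1 & 0 \\ x & 1\end{pmatrix}=x$. For $n=3$: $U^-_{>0}=\left\{\begin{pmatrix}1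 & 0 & 0 \\ a & 1 & 0 \\ c & b & 1\end{pmatrix}: a>0,\ b>0,\ c>0,\ ab-c>0\right\}$, and for $u=\begin{pmatrix}1 & 0 & 0 \\ x & 1 & 0 \\ z & y & 1\end{pmatrix}\in U^-$ one has $Z_1(u)=z$, $Z_2(u)=xy-z$. *)

theory Defs
  imports "HOL-Analysis.Analysis"
begin

text \<open>
  Matrix indices live in the numeral types \<open>2\<close> and \<open>3\<close>, whose elements are \<open>1, 2\<close> and \<open>1, 2, 3\<close>
  (addition is modular, so \<open>y_gen i\<close> below is \<open>1 + a E\<^sub>i\<^sub>+\<^sub>1\<^sub>,\<^sub>i\<close> only for \<open>i\<close> different from the
  last index). The index set \<open>I = {1, \<dots>, n - 1}\<close> is the numeral type \<open>1\<close> for \<open>n = 2\<close> and \<open>2\<close> for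
  \<open>n = 3\<close>.
\<close>

definition y_gen :: "('n::{finite,one,plus}) \<Rightarrow> real \<Rightarrow> ((real, 'n) vec, 'n) vec" where
  "y_gen i a = mat 1 + (\<chi> r c. if r = i + 1 \<and> c = i then a else 0)"

definition T_pos :: "(real^'n^'n) set" where
  "T_pos = {t. (\<forall>i j. i \<noteq> j \<longrightarrow> t $ i $ j = 0) \<and> (\<forall>i. t $ i $ i > 0) \<and> det t = 1}"

text \<open>The longest Weyl group elements are \<open>s\<^sub>1\<close> and \<open>s\<^sub>1 s\<^sub>2 s\<^sub>1 = s\<^sub>2 s\<^sub>1 s\<^sub>2\<close>.\<close>

definition U2_pos :: "(real^2^2) set" where
  "U2_pos = {y_gen 1 a | a. a > 0}"

definition U3_pos :: "(real^3^3) set" where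
  "U3_pos = {y_gen 1 a ** y_gen 2 b ** y_gen 1 c | a b c. a > 0 \<and> b > 0 \<and> c > 0}"

text \<open>
  The \<open>j\<close>-th fundamental representation of \<open>SL\<^sub>n\<close> is the \<open>j\<close>-th exterior power of \<open>\<real>\<^sup>n\<close>, with
  canonical basis the wedges of standard basis vectors. So the coefficient of the lowest weight
  vector in \<open>u (e\<^sub>1 \<and> \<dots> \<and> e\<^sub>j)\<close> is the minor of \<open>u\<close> on the last \<open>j\<close> rows and first \<open>j\<close> columns.
\<close>

definition Z2 :: "1 \<Rightarrow> real^2^2 \<Rightarrow> real" where
  "Z2 j u = u $ 2 $ 1"

definition Z3 :: "2 \<Rightarrow> real^3^3 \<Rightarrow> real" where
  "Z3 j u = (if j = 1 then u $ 3 $ 1 else u $ 2 $ 1 * u $ 3 $ 2 - u $ 2 $ 2 * u $ 3 $ 1)"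

definition twist :: "real^'n^'n \<Rightarrow> real^'n^'n \<Rightarrow> real^'n^'n \<Rightarrow> real^'n^'n" where
  "twist u u' t = t ** u ** matrix_inv t ** matrix_inv u'"

definition T_set :: "(real^'n^'n) set \<Rightarrow> real^'n^'n \<Rightarrow> real^'n^'n \<Rightarrow> (real^'n^'n) set" where
  "T_set Upos u u' = {t \<in> T_pos. twist u u' t \<in> Upos}"

definition Theta_dom ::
    "(real^'n^'n) set \<Rightarrow> ((real^'n^'n) \<times> (real^'n^'n) \<times> (real^'n^'n)) set" where
  "Theta_dom Upos = {(u, u', t). u \<in> Upos \<and> u' \<in> Upos \<and> t \<in> T_set Upos u u'}"

definition Theta_cod ::
    "(real^'n^'n) set \<Rightarrow> ((real^'n^'n) \<times> (real^'n^'n) \<times> (real^'i)) set" where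
  "Theta_cod Upos = Upos \<times> Upos \<times> {z. \<forall>j. z $ j > 0}"

definition Theta ::
    "('i \<Rightarrow> real^'n^'n \<Rightarrow> real) \<Rightarrow> (real^'n^'n) \<times> (real^'n^'n) \<times> (real^'n^'n)
      \<Rightarrow> (real^'n^'n) \<times> (real^'n^'n) \<times> (real^'i)" where
  "Theta Z = (\<lambda>(u, u', t). (u, u', \<chi> j. Z j (twist u u' t)))"

lemma U2_pos_explicit:
  "U2_pos = {vector [vector [1, 0], vector [a, 1]] | a. a > 0}"
proof -
  have "(y_gen 1 a :: real^2^2) = vector [vector [1, 0], vector [a, 1]]" for a
    by (simp add: vec_eq_iff y_gen_def forall_2 mat_def)
  then show ?thesis by (simp add: U2_pos_def)
qed

lemma y3_121:
  "(y_gen 1 a ** y_gen 2 b ** y_gen 1 c :: real^3^3)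
    = vector [vector [1, 0, 0], vector [a + c, 1, 0], vector [b * c, b, 1]]"
  by (simp add: vec_eq_iff y_gen_def forall_3 mat_def matrix_matrix_mult_def sum_3)

lemma y3_212:
  "(y_gen 2 a ** y_gen 1 b ** y_gen 2 c :: real^3^3)
    = vector [vector [1, 0, 0], vector [b, 1, 0], vector [a * b, a + c, 1]]"
  by (simp add: vec_eq_iff y_gen_def forall_3 mat_def matrix_matrix_mult_def sum_3)

lemma U3_pos_explicit:
  "U3_pos = {vector [vector [1, 0, 0], vector [a, 1, 0], vector [c, b, 1]] | a b c.
      a > 0 \<and> b > 0 \<and> c > 0 \<and> a * b - c > 0}" (is "_ = ?R")
proof
  show "U3_pos \<subseteq> ?R"
  proof
    fix u assume "u \<in> U3_pos"
    then obtain a b c where *: "u = y_gen 1 a ** y_gen 2 b ** y_gen 1 c" "a > 0" "b > 0" "c > 0"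
      by (auto simp: U3_pos_def)
    have "a + c > 0" "b * c > 0" "(a + c) * b - b * c > 0"
      using * by (auto simp: algebra_simps)
    then show "u \<in> ?R" using *(3) unfolding *(1) y3_121 by blast
  qed
  show "?R \<subseteq> U3_pos"
  proof
    fix u assume "u \<in> ?R"
    then obtain a b c where
      *: "u = vector [vector [1, 0, 0], vector [a, 1, 0], vector [c, b, 1]]"
        "a > 0" "b > 0" "c > 0" "a * b - c > 0" by blast
    have "u = y_gen 1 ((a * b - c) / b) ** y_gen 2 b ** y_gen 1 (c / b)"
      using * by (simp add: y3_121 diff_divide_distrib)
    moreover have "(a * b - c) / b > 0" "c / b > 0" using * by auto
    ultimately show "u \<in> U3_pos" using * unfolding U3_pos_def by blast
  qed
qed

lemma U3_pos_other_word:
  "U3_pos = {y_gen 2 a ** y_gen 1 b ** y_gen 2 c | a b c. a > 0 \<and> b > 0 \<and> c > 0}" (is "_ = ?R")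
proof
  show "?R \<subseteq> U3_pos"
  proof
    fix u assume "u \<in> ?R"
    then obtain a b c where *: "u = y_gen 2 a ** y_gen 1 b ** y_gen 2 c" "a > 0" "b > 0" "c > 0" by blast
    have "b > 0" "a + c > 0" "a * b > 0" "b * (a + c) - a * b > 0"
      using * by (auto simp: algebra_simps)
    then show "u \<in> U3_pos"
      unfolding U3_pos_explicit *(1) y3_212 by blast
  qed
  show "U3_pos \<subseteq> ?R"
  proof
    fix u assume "u \<in> U3_pos"
    then obtain a b c where
      *: "u = vector [vector [1, 0, 0], vector [a, 1, 0], vector [c, b, 1]]"
        "a > 0" "b > 0" "c > 0" "a * b - c > 0" unfolding U3_pos_explicit by blast
    have "u = y_gen 2 (c / a) ** y_gen 1 a ** y_gen 2 ((a * b - c) / a)"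
      using * by (simp add: y3_212 diff_divide_distrib)
    moreover have "(a * b - c) / a > 0" "c / a > 0" using * by auto
    ultimately show "u \<in> ?R" using * by blast
  qed
qed

lemma Z2_explicit: "Z2 j (vector [vector [1, 0], vector [a, 1]]) = a"
  by (simp add: Z2_def)

lemma Z3_explicit:
  "Z3 1 (vector [vector [1, 0, 0], vector [a, 1, 0], vector [c, b, 1]]) = c"
  "Z3 2 (vector [vector [1, 0, 0], vector [a, 1, 0], vector [c, b, 1]]) = a * b - c"
  by (simp_all add: Z3_def)

end

theory Submission
  imports Defs
begin

text \<open>
  A torus element is determined by the ratios of consecutive diagonal entries \<open>p = t\<^sub>2 / t\<^sub>1\<close>,
  \<open>q = t\<^sub>3 / t\<^sub>2\<close>. For \<open>n = 2\<close> the equation \<open>a p - a' = z\<close> is linear in \<open>p\<close>. For \<open>n = 3\<close> write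
  \<open>x = a p - a'\<close> and \<open>y = b q - b'\<close> for the subdiagonal entries of the twisted product. The two
  equations \<open>Z\<^sub>1 = z\<^sub>1\<close>, \<open>Z\<^sub>2 = z\<^sub>2\<close> are equivalent to \<open>x y = z\<^sub>1 + z\<^sub>2\<close> and
  \<open>c b' x - (a b - c) a' y = K\<close> with \<open>K\<close> depending only on \<open>u, u', z\<close>. Eliminating \<open>y\<close>
  gives a quadratic equation for \<open>x\<close> whose leading and constant coefficients have opposite signs, so
  it has exactly one positive root, and this root depends continuously on the data.
\<close>

section \<open>The positive root of the quadratic equation\<close>

text \<open>The larger root of \<open>A * x\<^sup>2 - K * x - B * s = 0\<close>, which is what
  remains of \<open>A * x - B * y = K\<close>, \<open>x * y = s\<close> after eliminating
  \<open>y\<close>.\<close>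

definition pos_root :: "real \<Rightarrow> real \<Rightarrow> real \<Rightarrow> real \<Rightarrow> real" where
  "pos_root A B K s = (K + sqrt (K\<^sup>2 + 4 * A * B * s)) / (2 * A)"

text \<open>The square root exceeds \<open>\<bar>K\<bar>\<close>, so the numerator is positive even
  for negative \<open>K\<close>.\<close>

lemma pos_root_pos:
  assumes "A > 0" "B > 0" "s > 0"
  shows "pos_root A B K s > 0"
proof -
  have "\<bar>K\<bar> < sqrt (K\<^sup>2 + 4 * A * B * s)"
    using assms by (intro real_less_rsqrt) auto
  then show ?thesis using assms by (simp add: pos_root_def)
qed

lemma pos_root_eq:
  assumes "A > 0" "B > 0" "s > 0"
  shows "A * pos_root A B K s - B * (s / pos_root A B K s) = K"
proof -
  define x where "x = pos_root A B K s"
  have "x > 0" using pos_root_pos[OF assms] by (simp add: x_def)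
  have "2 * A * x - K = sqrt (K\<^sup>2 + 4 * A * B * s)"
    using assms by (simp add: x_def pos_root_def)
  then have "(2 * A * x - K)\<^sup>2 = K\<^sup>2 + 4 * A * B * s"
    using assms by (simp add: add_nonneg_nonneg)
  then have "4 * A * (A * x * x - K * x - B * s) = 0"
    by (simp add: power2_eq_square algebra_simps)
  then have "A * x * x - K * x - B * s = 0" using assms by simp
  then show ?thesis
    using \<open>x > 0\<close> by (simp add: x_def[symmetric] field_simps)
qed

text \<open>The discriminant becomes the perfect square of \<open>A * x + B * y\<close>, and
  \<open>K\<close> plus its root is \<open>2 * A * x\<close>.\<close>

lemma pos_root_unique:
  assumes "A > 0" "B > 0" "x > 0" "y > 0"
  shows "pos_root A B (A * x - B * y) (x * y) = x"
proof -
  have "(A * x - B * y)\<^sup>2 + 4 * A * B * (x * y) = (A * x + B * y)\<^sup>2"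
    by (simp add: power2_eq_square algebra_simps)
  then show ?thesis using assms by (simp add: pos_root_def field_simps)
qed

text \<open>\<open>sqrt\<close> is continuous on the whole real line, so only the denominator
  \<open>2 * A\<close> has to be kept away from zero.\<close>

lemma continuous_on_pos_root:
  assumes "continuous_on S A" "continuous_on S B" "continuous_on S K" "continuous_on S s"
    and "\<And>v. v \<in> S \<Longrightarrow> A v > 0"
  shows "continuous_on S (\<lambda>v. pos_root (A v) (B v) (K v) (s v))"
  unfolding pos_root_def using assms(5)
  by (intro continuous_intros assms(1-4)) fastforce

section \<open>Entrywise continuity and explicit matrix inverses\<close>

lemma continuous_on_matrix_componentwise:
  fixes f :: "'a::topological_space \<Rightarrow> real^'n^'m"
  assumes "\<And>i j. continuous_on S (\<lambda>v. f v $ i $ j)"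
  shows "continuous_on S f"
proof -
  have "continuous_on S (\<lambda>v. \<chi> i j. f v $ i $ j)"
    by (intro continuous_on_vec_lambda assms)
  then show ?thesis by simp
qed

text \<open>\<open>matrix_inv\<close> is a Hilbert choice; uniqueness of two-sided inverses
  identifies it with an inverse given by a formula.\<close>

lemma matrix_inv_unique:
  fixes A :: "'a::semiring_1^'n^'m"
  assumes "A ** B = mat 1" "B ** A = mat 1"
  shows "matrix_inv A = B"
proof -
  have "A ** matrix_inv A = mat 1 \<and> matrix_inv A ** A = mat 1"
    unfolding matrix_inv_def by (rule someI[of _ B]) (use assms in simp)
  then show ?thesis using assms by (metis matrix_mul_assoc matrix_mul_lid matrix_mul_rid)
qed

subsection \<open>The case of \<open>SL\<^sub>2\<close>\<close>

definition low2 :: "real \<Rightarrow> real^2^2" where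
  "low2 a = vector [vector [1, 0], vector [a, 1]]"

definition diag2 :: "real \<Rightarrow> real \<Rightarrow> real^2^2" where
  "diag2 r s = vector [vector [r, 0], vector [0, s]]"

text \<open>Determinant 1 together with the ratio \<open>p\<close> forces the second diagonal entry
  to have square \<open>p\<close>.\<close>

definition torus2 :: "real \<Rightarrow> real^2^2" where
  "torus2 p = diag2 (1 / sqrt p) (sqrt p)"

lemma low2_nth [simp]: "low2 a $ 2 $ 1 = a"
  by (simp add: low2_def)

lemma low2_in_U2_pos: "low2 a \<in> U2_pos \<longleftrightarrow> a > 0"
proof
  assume "low2 a \<in> U2_pos"
  then obtain a' where "low2 a = low2 a'" "a' > 0"
    by (auto simp: U2_pos_explicit low2_def)
  then show "a > 0" by (metis low2_nth)
qed (auto simp: U2_pos_explicit low2_def)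

lemma U2_posE:
  assumes "u \<in> U2_pos"
  obtains a where "u = low2 a" "a > 0"
  using assms by (auto simp: U2_pos_explicit low2_def)

lemma torus2_in_T_pos:
  assumes "p > 0"
  shows "torus2 p \<in> T_pos"
  using assms by (simp add: T_pos_def torus2_def diag2_def forall_2 det_2)

lemma T_pos2_eq_torus2:
  fixes t :: "real^2^2"
  assumes "t \<in> T_pos"
  shows "t $ 2 $ 2 / t $ 1 $ 1 > 0" and "t = torus2 (t $ 2 $ 2 / t $ 1 $ 1)"
proof -
  define r s where "r = t $ 1 $ 1" and "s = t $ 2 $ 2"
  have *: "r > 0" "s > 0" "r * s = 1" "t $ 1 $ 2 = 0" "t $ 2 $ 1 = 0"
    using assms by (auto simp: T_pos_def forall_2 det_2 r_def s_def)
  then have r: "r = 1 / s" by (simp add: field_simps)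
  have "s / r = s\<^sup>2" using * by (simp add: r power2_eq_square)
  then have "sqrt (s / r) = s" using * by simp
  then show "t = torus2 (t $ 2 $ 2 / t $ 1 $ 1)"
    using * r by (simp add: torus2_def diag2_def vec_eq_iff forall_2 flip: r_def s_def)
  show "t $ 2 $ 2 / t $ 1 $ 1 > 0" using * by (simp flip: r_def s_def)
qed

lemma T_pos2E:
  fixes t :: "real^2^2"
  assumes "t \<in> T_pos"
  obtains p where "t = torus2 p" "p > 0"
  using T_pos2_eq_torus2[OF assms] by blast

lemma torus2_ratio:
  assumes "p > 0"
  shows "torus2 p $ 2 $ 2 / torus2 p $ 1 $ 1 = p"
  using assms by (simp add: torus2_def diag2_def)

text \<open>Conjugation by the torus element scales the subdiagonal entry by \<open>p\<close>; the
  inverse of \<open>low2 a'\<close> then subtracts \<open>a'\<close>.\<close>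

lemma twist2:
  assumes "p > 0"
  shows "twist (low2 a) (low2 a') (torus2 p) = low2 (a * p - a')"
proof -
  have "matrix_inv (low2 a') = low2 (- a')"
    by (rule matrix_inv_unique)
      (simp_all add: low2_def vec_eq_iff forall_2 matrix_matrix_mult_def sum_2 mat_def)
  moreover have "matrix_inv (torus2 p) = diag2 (sqrt p) (1 / sqrt p)"
    by (rule matrix_inv_unique)
      (use assms in \<open>simp_all add: torus2_def diag2_def vec_eq_iff forall_2
        matrix_matrix_mult_def sum_2 mat_def\<close>)
  ultimately show ?thesis using assms
    by (simp add: twist_def torus2_def low2_def diag2_def vec_eq_iff forall_2
        matrix_matrix_mult_def sum_2)
qed

text \<open>Solves \<open>a * p - a' = z\<close> for \<open>p\<close>.\<close>

definition Psi2 :: "(real^2^2) \<times> (real^2^2) \<times> (real^1) \<Rightarrow> (real^2^2) \<times> (real^2^2) \<times> (real^2^2)"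
  where "Psi2 = (\<lambda>(u, u', z). (u, u', torus2 ((z $ 1 + u' $ 2 $ 1) / u $ 2 $ 1)))"

lemma Theta_dom2E:
  assumes "v \<in> Theta_dom U2_pos"
  obtains a a' p where "v = (low2 a, low2 a', torus2 p)" "a > 0" "a' > 0" "p > 0"
    "a * p - a' > 0"
proof -
  obtain u u' t where v: "v = (u, u', t)" "u \<in> U2_pos" "u' \<in> U2_pos" "t \<in> T_pos"
    "twist u u' t \<in> U2_pos"
    using assms by (auto simp: Theta_dom_def T_set_def)
  obtain a a' p where "u = low2 a" "a > 0" "u' = low2 a'" "a' > 0" "t = torus2 p" "p > 0"
    using v by (metis U2_posE T_pos2E)
  then show thesis using v that by (simp add: twist2 low2_in_U2_pos)
qed

lemma Theta_cod2E:
  assumes "w \<in> Theta_cod U2_pos"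
  obtains a a' and z :: "real^1" where "w = (low2 a, low2 a', z)" "a > 0" "a' > 0" "z $ 1 > 0"
proof -
  obtain u u' z where "w = (u, u', z)" "u \<in> U2_pos" "u' \<in> U2_pos" "z $ 1 > 0"
    using assms by (auto simp: Theta_cod_def)
  then show thesis using that by (metis U2_posE)
qed

text \<open>On the domain this removes \<open>matrix_inv\<close>, leaving a rational function of the
  entries whose continuity is immediate.\<close>

lemma Theta2_eq:
  assumes "v \<in> Theta_dom U2_pos"
  shows "Theta Z2 v = (case v of (u, u', t) \<Rightarrow>
    (u, u', \<chi> j. u $ 2 $ 1 * (t $ 2 $ 2 / t $ 1 $ 1) - u' $ 2 $ 1))"
  using assms
  by (elim Theta_dom2E)
    (simp add: Theta_def Z2_def twist2 torus2_ratio vec_eq_iff del: times_divide_eq_right)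

lemma continuous_on_Theta2: "continuous_on (Theta_dom U2_pos) (Theta Z2)"
proof -
  have "(snd (snd v)) $ 1 $ 1 \<noteq> 0" if "v \<in> Theta_dom U2_pos" for v
    using that by (auto simp: Theta_dom_def T_set_def T_pos_def less_imp_neq[symmetric])
  then have "continuous_on (Theta_dom U2_pos) (\<lambda>v. case v of (u, u', t) \<Rightarrow>
      (u, u', (\<chi> j. u $ 2 $ 1 * (t $ 2 $ 2 / t $ 1 $ 1) - u' $ 2 $ 1) :: real^1))"
    unfolding case_prod_unfold by (intro continuous_intros continuous_on_vec_lambda) auto
  then show ?thesis by (subst continuous_on_cong[OF refl Theta2_eq]) auto
qed

lemma continuous_on_Psi2: "continuous_on (Theta_cod U2_pos) Psi2"
proof -
  let ?S = "Theta_cod U2_pos :: ((real^2^2) \<times> (real^2^2) \<times> (real^1)) set"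
  define p where "p = (\<lambda>(u :: real^2^2, u' :: real^2^2, z :: real^1).
    (z $ 1 + u' $ 2 $ 1) / u $ 2 $ 1)"
  have "fst w $ 2 $ 1 \<noteq> 0" if "w \<in> ?S" for w
    using that by (elim Theta_cod2E) auto
  then have p: "continuous_on ?S p"
    unfolding p_def case_prod_unfold by (intro continuous_intros) auto
  have pos: "p w \<noteq> 0" if "w \<in> ?S" for w
    using that by (elim Theta_cod2E) (auto simp: p_def)
  have "continuous_on ?S (\<lambda>w. torus2 (p w) $ i $ j)" for i j
    using exhaust_2[of i] exhaust_2[of j]
    by (elim disjE; simp only: torus2_def diag2_def vector_2)
      (intro continuous_on_divide continuous_on_real_sqrt continuous_on_const p; use pos in simp)+
  then have "continuous_on ?S (\<lambda>w. torus2 (p w))"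
    by (rule continuous_on_matrix_componentwise)
  then have "continuous_on ?S (\<lambda>w. (fst w, fst (snd w), torus2 (p w)))"
    by (intro continuous_intros)
  then show ?thesis by (simp add: Psi2_def p_def case_prod_unfold)
qed

lemma homeomorphism_Theta2:
  "homeomorphism (Theta_dom U2_pos) (Theta_cod U2_pos) (Theta Z2) Psi2"
proof (rule homeomorphismI[OF continuous_on_Theta2 continuous_on_Psi2])
  show "Theta Z2 ` Theta_dom U2_pos \<subseteq> Theta_cod U2_pos"
    by (auto elim!: Theta_dom2E simp: Theta_def Theta_cod_def Z2_def twist2 low2_in_U2_pos)
  show "Psi2 ` Theta_cod U2_pos \<subseteq> Theta_dom U2_pos"
    by (auto elim!: Theta_cod2E simp: Psi2_def Theta_dom_def T_set_def twist2 low2_in_U2_pos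
        torus2_in_T_pos)
  show "Psi2 (Theta Z2 v) = v" if "v \<in> Theta_dom U2_pos" for v
    using that by (elim Theta_dom2E) (simp add: Theta_def Psi2_def Z2_def twist2)
  show "Theta Z2 (Psi2 w) = w" if "w \<in> Theta_cod U2_pos" for w
    using that by (elim Theta_cod2E) (simp add: Theta_def Psi2_def Z2_def twist2 vec_eq_iff)
qed

subsection \<open>The case of \<open>SL\<^sub>3\<close>\<close>

definition low3 :: "real \<Rightarrow> real \<Rightarrow> real \<Rightarrow> real^3^3" where
  "low3 a b c = vector [vector [1, 0, 0], vector [a, 1, 0], vector [c, b, 1]]"

definition diag3 :: "real \<Rightarrow> real \<Rightarrow> real \<Rightarrow> real^3^3" where
  "diag3 r s w = vector [vector [r, 0, 0], vector [0, s, 0], vector [0, 0, w]]"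

text \<open>The diagonal \<open>r, r * p, r * p * q\<close> has the prescribed ratios; determinant 1
  forces \<open>r ^ 3 = 1 / (p\<^sup>2 * q)\<close>.\<close>

definition torus3 :: "real \<Rightarrow> real \<Rightarrow> real^3^3" where
  "torus3 p q = (let r = root 3 (1 / (p\<^sup>2 * q)) in diag3 r (r * p) (r * p * q))"

lemma low3_nth [simp]:
  "low3 a b c $ 2 $ 1 = a" "low3 a b c $ 3 $ 2 = b" "low3 a b c $ 3 $ 1 = c"
  "low3 a b c $ 2 $ 2 = 1"
  by (simp_all add: low3_def)

lemma low3_in_U3_pos: "low3 a b c \<in> U3_pos \<longleftrightarrow> a > 0 \<and> b > 0 \<and> c > 0 \<and> a * b - c > 0"
proof
  assume "low3 a b c \<in> U3_pos"
  then obtain a' b' c' where *: "low3 a b c = low3 a' b' c'"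
      "a' > 0" "b' > 0" "c' > 0" "a' * b' - c' > 0"
    by (auto simp: U3_pos_explicit low3_def)
  have "a = a'" "b = b'" "c = c'" using *(1) by (metis low3_nth)+
  then show "a > 0 \<and> b > 0 \<and> c > 0 \<and> a * b - c > 0" using * by simp
qed (auto simp: U3_pos_explicit low3_def)

lemma U3_posE:
  assumes "u \<in> U3_pos"
  obtains a b c where "u = low3 a b c" "a > 0" "b > 0" "c > 0" "a * b - c > 0"
  using assms by (auto simp: U3_pos_explicit low3_def)

lemma torus3_in_T_pos:
  assumes "p > 0" "q > 0"
  shows "torus3 p q \<in> T_pos"
proof -
  define r where "r = root 3 (1 / (p\<^sup>2 * q))"
  have "r > 0" using assms by (simp add: r_def)
  have "r ^ 3 = 1 / (p\<^sup>2 * q)" using assms by (simp add: r_def)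
  then have "r * (r * p) * (r * p * q) = 1"
    using assms by (simp add: field_simps power2_eq_square power3_eq_cube)
  then show ?thesis
    using assms \<open>r > 0\<close>
    by (simp add: T_pos_def torus3_def Let_def diag3_def forall_3 det_3 flip: r_def)
qed

lemma T_pos3E:
  fixes t :: "real^3^3"
  assumes "t \<in> T_pos"
  obtains p q where "t = torus3 p q" "p > 0" "q > 0"
proof -
  define r s w where "r = t $ 1 $ 1" and "s = t $ 2 $ 2" and "w = t $ 3 $ 3"
  have *: "r > 0" "s > 0" "w > 0" "r * s * w = 1"
    "t $ 1 $ 2 = 0" "t $ 2 $ 1 = 0" "t $ 1 $ 3 = 0" "t $ 3 $ 1 = 0" "t $ 2 $ 3 = 0" "t $ 3 $ 2 = 0"
    using assms by (auto simp: T_pos_def forall_3 det_3 r_def s_def w_def)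
  \<comment> \<open>With determinant \<open>r * s * w = 1\<close> the right-hand side is
    \<open>r ^ 3\<close>, so the cube root in \<open>torus3\<close> recovers
    \<open>r\<close>.\<close>
  have "1 / ((s / r)\<^sup>2 * (w / s)) = r ^ 3 / (r * s * w)"
    using *(1-3) by (simp add: field_simps power2_eq_square power3_eq_cube)
  then have "root 3 (1 / ((s / r)\<^sup>2 * (w / s))) = r"
    using * by (simp add: real_root_power_cancel)
  then have "t = torus3 (s / r) (w / s)"
    using * by (simp add: torus3_def diag3_def vec_eq_iff forall_3 flip: r_def s_def w_def)
  then show thesis using that * by simp
qed

lemma torus3_ratio:
  assumes "p > 0" "q > 0"
  shows "torus3 p q $ 2 $ 2 / torus3 p q $ 1 $ 1 = p"
    and "torus3 p q $ 3 $ 3 / torus3 p q $ 2 $ 2 = q"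
  using assms by (simp_all add: torus3_def diag3_def Let_def)

text \<open>Conjugation scales \<open>a\<close>, \<open>b\<close>, \<open>c\<close> by
  \<open>p\<close>, \<open>q\<close>, \<open>p * q\<close>; the inverse of
  \<open>low3 a' b' c'\<close> is \<open>low3 (- a') (- b') (a' * b' - c')\<close>.\<close>

lemma twist3:
  assumes "p > 0" "q > 0"
  shows "twist (low3 a b c) (low3 a' b' c') (torus3 p q) =
    low3 (a * p - a') (b * q - b') (c * p * q - a' * b * q + a' * b' - c')"
proof -
  define r where "r = root 3 (1 / (p\<^sup>2 * q))"
  have "r > 0" using assms by (simp add: r_def)
  have t: "torus3 p q = diag3 r (r * p) (r * p * q)" by (simp add: torus3_def r_def Let_def)
  have inv_low: "matrix_inv (low3 a' b' c') = low3 (- a') (- b') (a' * b' - c')"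
    by (rule matrix_inv_unique)
      (simp_all add: low3_def vec_eq_iff forall_3 matrix_matrix_mult_def sum_3 mat_def)
  have inv_torus: "matrix_inv (torus3 p q) = diag3 (1 / r) (1 / (r * p)) (1 / (r * p * q))"
    unfolding t
    by (rule matrix_inv_unique)
      (use assms \<open>r > 0\<close> in \<open>simp_all add: diag3_def vec_eq_iff forall_3
        matrix_matrix_mult_def sum_3 mat_def\<close>)
  show ?thesis unfolding twist_def inv_low inv_torus unfolding t
    using assms \<open>r > 0\<close>
    by (simp add: low3_def diag3_def vec_eq_iff forall_3 matrix_matrix_mult_def sum_3 field_simps)
qed

text \<open>The second value is \<open>(a * p - a') * (b * q - b')\<close> minus the first; the
  terms \<open>a' * b * q\<close> and \<open>a' * b'\<close> cancel.\<close>

lemma Z3_twist3: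
  assumes "p > 0" "q > 0"
  shows "Z3 j (twist (low3 a b c) (low3 a' b' c') (torus3 p q)) =
    (if j = 1 then c * p * q - a' * b * q + a' * b' - c' else (a * b - c) * p * q - a * b' * p + c')"
  using assms by (simp add: Z3_def twist3 algebra_simps)

text \<open>The entry \<open>x = a p - a'\<close> of the twisted product, recovered from the values of \<open>Z3\<close>.\<close>

definition sub_entry :: "(real^3^3) \<times> (real^3^3) \<times> (real^2) \<Rightarrow> real" where
  "sub_entry = (\<lambda>(u, u', z).
    let a = u $ 2 $ 1; b = u $ 3 $ 2; c = u $ 3 $ 1;
        a' = u' $ 2 $ 1; b' = u' $ 3 $ 2; c' = u' $ 3 $ 1
    in pos_root (c * b') ((a * b - c) * a')
         (a * b * (z $ 1 + c') - c * (a' * b' + (z $ 1 + z $ 2))) (z $ 1 + z $ 2))"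

text \<open>Once \<open>x\<close> is known, the other subdiagonal entry is
  \<open>(z $ 1 + z $ 2) / x\<close>; then \<open>x = a * p - a'\<close> and
  \<open>y = b * q - b'\<close> are solved for \<open>p\<close> and \<open>q\<close>.\<close>

definition Psi3 :: "(real^3^3) \<times> (real^3^3) \<times> (real^2) \<Rightarrow> (real^3^3) \<times> (real^3^3) \<times> (real^3^3)"
  where "Psi3 = (\<lambda>(u, u', z). let x = sub_entry (u, u', z) in
    (u, u', torus3 ((u' $ 2 $ 1 + x) / u $ 2 $ 1) ((u' $ 3 $ 2 + (z $ 1 + z $ 2) / x) / u $ 3 $ 2)))"

lemma Theta_dom3E:
  assumes "v \<in> Theta_dom U3_pos"
  obtains a b c a' b' c' p q where "v = (low3 a b c, low3 a' b' c', torus3 p q)"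
    "a > 0" "b > 0" "c > 0" "a * b - c > 0" "a' > 0" "b' > 0" "c' > 0" "a' * b' - c' > 0"
    "p > 0" "q > 0" "a * p - a' > 0" "b * q - b' > 0"
    "c * p * q - a' * b * q + a' * b' - c' > 0" "(a * b - c) * p * q - a * b' * p + c' > 0"
proof -
  obtain u u' t where v: "v = (u, u', t)" "u \<in> U3_pos" "u' \<in> U3_pos" "t \<in> T_pos"
    "twist u u' t \<in> U3_pos"
    using assms by (auto simp: Theta_dom_def T_set_def)
  obtain a b c where u: "u = low3 a b c" "a > 0" "b > 0" "c > 0" "a * b - c > 0"
    using v by (metis U3_posE)
  obtain a' b' c' where u': "u' = low3 a' b' c'" "a' > 0" "b' > 0" "c' > 0" "a' * b' - c' > 0"
    using v by (metis U3_posE)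
  obtain p q where t: "t = torus3 p q" "p > 0" "q > 0"
    using v by (metis T_pos3E)
  \<comment> \<open>Rewrites the last inequality of \<open>low3_in_U3_pos\<close> as positivity of
    the second value of \<open>Z3\<close>.\<close>
  have "(a * p - a') * (b * q - b') - (c * p * q - a' * b * q + a' * b' - c')
      = (a * b - c) * p * q - a * b' * p + c'"
    by (simp add: algebra_simps)
  then show thesis
    using v(5) that[OF _ u(2-5) u'(2-5) t(2,3)] t(2,3) unfolding v(1) u(1) u'(1) t(1)
    by (simp add: twist3 low3_in_U3_pos)
qed

lemma Theta_cod3E:
  assumes "w \<in> Theta_cod U3_pos"
  obtains a b c a' b' c' and z :: "real^2" where "w = (low3 a b c, low3 a' b' c', z)"
    "a > 0" "b > 0" "c > 0" "a * b - c > 0" "a' > 0" "b' > 0" "c' > 0" "a' * b' - c' > 0"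
    "z $ 1 > 0" "z $ 2 > 0"
proof -
  obtain u u' z where "w = (u, u', z)" "u \<in> U3_pos" "u' \<in> U3_pos" "z $ 1 > 0" "z $ 2 > 0"
    using assms by (auto simp: Theta_cod_def)
  then show thesis using that by (elim U3_posE) blast
qed

lemma sub_entry_pos:
  assumes "w \<in> Theta_cod U3_pos"
  shows "sub_entry w > 0"
  using assms by (elim Theta_cod3E) (auto simp: sub_entry_def intro!: pos_root_pos)

lemma Theta3_eq:
  assumes "v \<in> Theta_dom U3_pos"
  shows "Theta Z3 v = (case v of (u, u', t) \<Rightarrow>
    let a = u $ 2 $ 1; b = u $ 3 $ 2; c = u $ 3 $ 1;
        a' = u' $ 2 $ 1; b' = u' $ 3 $ 2; c' = u' $ 3 $ 1;
        p = t $ 2 $ 2 / t $ 1 $ 1; q = t $ 3 $ 3 / t $ 2 $ 2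
    in (u, u', \<chi> j. if j = 1 then c * p * q - a' * b * q + a' * b' - c'
                     else (a * b - c) * p * q - a * b' * p + c'))"
  using assms
  by (elim Theta_dom3E)
    (simp add: Theta_def Z3_twist3 torus3_ratio vec_eq_iff
      del: times_divide_eq_right times_divide_eq_left)

section \<open>Continuity of the map and its inverse\<close>

lemma continuous_on_Theta3: "continuous_on (Theta_dom U3_pos) (Theta Z3)"
proof -
  have nz: "(snd (snd v)) $ i $ i \<noteq> 0" if "v \<in> Theta_dom U3_pos" for v i
    using that by (auto simp: Theta_dom_def T_set_def T_pos_def less_imp_neq[symmetric])
  \<comment> \<open>The condition involves only the fixed index \<open>j\<close>, so each coordinate
    function is one of the two branches throughout.\<close>
  have if_cont: "continuous_on S (\<lambda>v. if j = (1::2) then f v else g v)"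
    if "continuous_on S f" "continuous_on S g"
    for S j and f g :: "(real^3^3) \<times> (real^3^3) \<times> (real^3^3) \<Rightarrow> real"
    using that by (cases "j = 1") simp_all
  show ?thesis
    by (subst continuous_on_cong[OF refl Theta3_eq], assumption, unfold case_prod_unfold Let_def,
        intro continuous_intros continuous_on_vec_lambda if_cont) (auto simp: nz)
qed

lemma continuous_on_sub_entry: "continuous_on (Theta_cod U3_pos) sub_entry"
  unfolding sub_entry_def case_prod_unfold Let_def
  by (intro continuous_on_pos_root continuous_intros) (auto elim!: Theta_cod3E)

lemma continuous_on_Psi3: "continuous_on (Theta_cod U3_pos) Psi3"
proof -
  let ?S = "Theta_cod U3_pos :: ((real^3^3) \<times> (real^3^3) \<times> (real^2)) set"
  define p where "p = (\<lambda>w :: (real^3^3) \<times> (real^3^3) \<times> (real^2).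
    (fst (snd w) $ 2 $ 1 + sub_entry w) / fst w $ 2 $ 1)"
  define q where "q = (\<lambda>w :: (real^3^3) \<times> (real^3^3) \<times> (real^2).
    (fst (snd w) $ 3 $ 2 + (snd (snd w) $ 1 + snd (snd w) $ 2) / sub_entry w) / fst w $ 3 $ 2)"
  have nz: "fst w $ 2 $ 1 \<noteq> 0" "fst w $ 3 $ 2 \<noteq> 0" "sub_entry w \<noteq> 0" if "w \<in> ?S" for w
    using that sub_entry_pos[OF that] by (auto elim!: Theta_cod3E)
  have p: "continuous_on ?S p" unfolding p_def
    by (intro continuous_intros continuous_on_sub_entry) (auto simp: nz)
  have q: "continuous_on ?S q" unfolding q_def
    by (intro continuous_intros continuous_on_sub_entry) (auto simp: nz)
  have pos: "p w > 0 \<and> q w > 0" if "w \<in> ?S" for w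
    using that sub_entry_pos[OF that]
    by (elim Theta_cod3E) (auto simp: p_def q_def intro!: divide_pos_pos add_pos_pos)
  have r: "continuous_on ?S (\<lambda>w. root 3 (1 / ((p w)\<^sup>2 * q w)))"
    by (intro continuous_intros p q) (use pos in fastforce)
  have "continuous_on ?S (\<lambda>w. torus3 (p w) (q w) $ i $ j)" for i j
    using exhaust_3[of i] exhaust_3[of j]
    by (elim disjE; simp only: torus3_def Let_def diag3_def vector_3)
      (intro continuous_on_mult continuous_on_const r p q)+
  then have "continuous_on ?S (\<lambda>w. torus3 (p w) (q w))"
    by (rule continuous_on_matrix_componentwise)
  then have "continuous_on ?S (\<lambda>w. (fst w, fst (snd w), torus3 (p w) (q w)))"
    by (intro continuous_intros)
  then show ?thesis by (simp add: Psi3_def p_def q_def case_prod_unfold Let_def)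
qed

section \<open>The two maps are mutually inverse\<close>

lemma Psi3_Theta3:
  assumes "v \<in> Theta_dom U3_pos"
  shows "Psi3 (Theta Z3 v) = v"
proof -
  obtain a b c a' b' c' p q where v: "v = (low3 a b c, low3 a' b' c', torus3 p q)"
    "a > 0" "b > 0" "c > 0" "a * b - c > 0" "a' > 0" "b' > 0" "c' > 0" "a' * b' - c' > 0"
    "p > 0" "q > 0" "a * p - a' > 0" "b * q - b' > 0"
    using assms by (elim Theta_dom3E)
  define x y where "x = a * p - a'" and "y = b * q - b'"
  define z1 z2 where "z1 = c * p * q - a' * b * q + a' * b' - c'"
    and "z2 = (a * b - c) * p * q - a * b' * p + c'"
  have s: "z1 + z2 = x * y"
    by (simp add: z1_def z2_def x_def y_def algebra_simps)
  \<comment> \<open>Multiplying \<open>z1\<close> by \<open>a * b\<close> leaves \<open>p\<close>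
    and \<open>q\<close> only in \<open>a * p = a' + x\<close> and \<open>b * q = b' + y\<close>;
    with \<open>x * y\<close> moved to the left, the rest is linear in \<open>x\<close> and
    \<open>y\<close>.\<close>
  have K: "a * b * (z1 + c') - c * (a' * b' + x * y) = c * b' * x - (a * b - c) * a' * y"
    by (simp add: z1_def x_def y_def algebra_simps)
  have "x > 0" "y > 0" using v by (simp_all add: x_def y_def)
  have Theta: "Theta Z3 v = (low3 a b c, low3 a' b' c', \<chi> j. if j = 1 then z1 else z2)"
    using v by (simp add: Theta_def Z3_twist3 z1_def z2_def vec_eq_iff)
  have "sub_entry (Theta Z3 v) = x"
    using v \<open>x > 0\<close> \<open>y > 0\<close> unfolding Theta
    by (simp add: sub_entry_def s K pos_root_unique)
  then have "Psi3 (Theta Z3 v) = (low3 a b c, low3 a' b' c', torus3 ((a' + x) / a) ((b' + y) / b))"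
    using \<open>x > 0\<close> by (simp add: Theta Psi3_def s)
  then show ?thesis using v by (simp add: x_def y_def)
qed

lemma Psi3_in_Theta_dom_and_Theta3_Psi3:
  assumes "w \<in> Theta_cod U3_pos"
  shows "Psi3 w \<in> Theta_dom U3_pos \<and> Theta Z3 (Psi3 w) = w"
proof -
  obtain a b c a' b' c' and z :: "real^2" where w: "w = (low3 a b c, low3 a' b' c', z)"
    "a > 0" "b > 0" "c > 0" "a * b - c > 0" "a' > 0" "b' > 0" "c' > 0" "a' * b' - c' > 0"
    "z $ 1 > 0" "z $ 2 > 0"
    using assms by (elim Theta_cod3E)
  define x y where "x = sub_entry w" and "y = (z $ 1 + z $ 2) / x"
  have "x > 0" using sub_entry_pos[OF assms] by (simp add: x_def)
  then have "y > 0" using w by (simp add: y_def)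
  have s: "x * y = z $ 1 + z $ 2" using \<open>x > 0\<close> by (simp add: y_def)
  \<comment> \<open>This is \<open>pos_root_eq\<close> for the coefficients in
    \<open>sub_entry\<close>, with the sum of the \<open>z\<close> coordinates written as
    \<open>x * y\<close>.\<close>
  have K: "c * b' * x - (a * b - c) * a' * y = a * b * (z $ 1 + c') - c * (a' * b' + x * y)"
    unfolding s unfolding y_def x_def w(1) sub_entry_def
    using pos_root_eq[of "c * b'" "(a * b - c) * a'" "z $ 1 + z $ 2"
        "a * b * (z $ 1 + c') - c * (a' * b' + (z $ 1 + z $ 2))"] w
    by simp
  define p q where "p = (a' + x) / a" and "q = (b' + y) / b"
  have pq: "p > 0" "q > 0" using w \<open>x > 0\<close> \<open>y > 0\<close> by (simp_all add: p_def q_def add_pos_pos)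
  have Psi: "Psi3 w = (low3 a b c, low3 a' b' c', torus3 p q)"
    by (simp add: Psi3_def Let_def w(1) p_def q_def y_def x_def)
  have xp: "a * p = a' + x" and yq: "b * q = b' + y"
    using w by (simp_all add: p_def q_def)
  \<comment> \<open>The factor \<open>a * b\<close> clears the denominators of \<open>p\<close> and
    \<open>q\<close>, so that \<open>K\<close> applies; being positive, it cancels
    afterwards.\<close>
  have "a * b * (c * p * q - a' * b * q + a' * b' - c')
      = c * (a * p) * (b * q) - a * b * (a' * (b * q) - a' * b' + c')"
    by (simp add: algebra_simps)
  also have "\<dots> = a * b * z $ 1" using K unfolding xp yq by (simp add: algebra_simps)
  finally have z1: "c * p * q - a' * b * q + a' * b' - c' = z $ 1"
    using w by simp
  have "(a * b - c) * p * q - a * b' * p + c'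
      = (a * p - a') * (b * q - b') - (c * p * q - a' * b * q + a' * b' - c')"
    by (simp add: algebra_simps)
  also have "\<dots> = z $ 2" unfolding z1 xp yq using s by simp
  finally have z2: "(a * b - c) * p * q - a * b' * p + c' = z $ 2" .
  \<comment> \<open>Membership in \<open>U3_pos\<close> now follows, the last inequality being
    \<open>x * y - z $ 1 = z $ 2 > 0\<close>.\<close>
  have "twist (low3 a b c) (low3 a' b' c') (torus3 p q) = low3 x y (z $ 1)"
    using pq by (simp add: twist3 z1) (simp add: xp yq)
  then have "Psi3 w \<in> Theta_dom U3_pos"
    using w pq \<open>x > 0\<close> \<open>y > 0\<close> s unfolding Psi
    by (simp add: Theta_dom_def T_set_def low3_in_U3_pos torus3_in_T_pos)
  moreover have "Theta Z3 (Psi3 w) = w"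
    unfolding Psi unfolding w(1) using pq by (simp add: Theta_def Z3_twist3 z1 z2 vec_eq_iff forall_2)
  ultimately show ?thesis ..
qed

lemma homeomorphism_Theta3:
  "homeomorphism (Theta_dom U3_pos) (Theta_cod U3_pos) (Theta Z3) Psi3"
proof (rule homeomorphismI[OF continuous_on_Theta3 continuous_on_Psi3])
  show "Theta Z3 ` Theta_dom U3_pos \<subseteq> Theta_cod U3_pos"
    by (auto elim!: Theta_dom3E simp: Theta_def Theta_cod_def Z3_twist3 low3_in_U3_pos)
qed (use Psi3_Theta3 Psi3_in_Theta_dom_and_Theta3_Psi3 in blast)+

theorem mainTheorem5:
  "(\<exists>\<Psi>. homeomorphism (Theta_dom U2_pos) (Theta_cod U2_pos) (Theta Z2) \<Psi>) \<and>
   (\<exists>\<Psi>. homeomorphism (Theta_dom U3_pos) (Theta_cod U3_pos) (Theta Z3) \<Psi>)"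
  using homeomorphism_Theta2 homeomorphism_Theta3 by blast

end
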